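(* There exist absolute constants $C>0$ and $T_0\in\mathbb{Z}_{>0}$ such that for any $b,h\in[0,1]$, $K\ge 0$, $L\in\mathbb{Z}_{\ge 0}$, $T\in\mathbb{Z}_{\ge T_0}$, $H>0$, and $\underline{H}\le H$, the class $\mathcal{L}(\Pi_{(s,S)})=\{\ell((s,S),\cdot):(s,S)\in\Pi_{(s,S)}\}$ of loss functions induced by $\Pi_{(s,S)}=\{(s,S):\underline{H}\le s\le S\le H,\ S\ge 0\}$ satisfies $\mathrm{P\text{-}dim}(\mathcal{L}(\Pi_{(s,S)}))\le C\log T$.
   Context: Inventory model (backlogged demand, lead time $L$). There are $T+L$ periods; a demand sequence is $\mathbf{d}=(d^1,\dots,d^{T+L})\in[0,U]^{T+L}$, where $U>0$ is a fixed constant. Let $x^t$ be the inventory level at the beginning of period $t$ and $q^t\ge 0$ the quantity ordered in period $t$ (arriving in period $t+L$), with $q^t=0$ for $t\le 0$. The inventory position before ordering is $I^t=x^t+\sum_{t'=t-L}^{t-1}q^{t'}$. After replenishment the inventory level is $y^t=x^t+q^{t-L}$, and $x^{t+1}=y^t-d^t$. Let $c(x)=h\max\{x,0\}+b\max\{-x,0\}$. The loss in period $t$ of a policy $\pi$ is $\ell^t(\pi,\mathbf{d})=c(y^t-d^t)+K\cdot\mathbb{I}\{q^{t-L}>0\}$, and the loss is $\ell(\pi,\mathbf{d})=\frac1T\sum_{t=L+1}^{T+L}\ell^t(\pi,\mathbf{d})$. $(s,S)$ policies: the policy $(s,S)$ orders $q^t=(S-I^t)\cdot\mathbb{I}\{I^t\le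 s\}$ in every period $t\ge 1$. The initial level $x^1$ is a fixed non-positive constant with $x^1\le\underline{H}$ (so that replenishment up to $S$ occurs in period 1). Pseudo-dimension: a dataset $(\mathbf{d}_i)_{i=1}^m$ in $[0,U]^{T+L}$ is shattered by a class $\{f(\pi,\cdot):\pi\in\Pi\}$ of real-valued functions if there exist $\tau_1,\dots,\tau_m\in\mathbb{R}$ such that for every $A\subseteq\{1,\dots,m\}$ there is $\pi\in\Pi$ with $f(\pi,\mathbf{d}_i)>\tau_i$ for all $i\in A$ and $f(\pi,\mathbf{d}_i)\le\tau_i$ for all $i\notin A$. The Pseudo-dimension $\mathrm{P\text{-}dim}$ is the maximum size of a dataset that can be shattered. *)

theory Defs
  imports Complex_Main "HOL-Library.Extended_Real" "HOL-Library.FuncSet"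
begin

text \<open>
  Inventory model with backlogged demand and lead time \<open>L\<close>. Periods are the natural numbers
  \<open>t \<ge> 1\<close>; a demand sequence is a function \<open>d\<close> on periods. A policy \<open>\<pi>\<close> maps the inventory position
  before ordering to the quantity ordered.

  The index \<open>0\<close> stands for all periods \<open>t \<le> 0\<close>: nothing is ordered there, so truncated
  subtraction in \<open>t - L\<close> gives \<open>q\<^sup>t\<^sup>-\<^sup>L = 0\<close> for \<open>t \<le> L\<close>, and in the inventory position it only
  drops vanishing summands. The inventory level at index \<open>0\<close> is meaningless and never used.
\<close>

type_synonym policy = "real \<Rightarrow> real"

function inv_level :: "nat \<Rightarrow> real \<Rightarrow> policy \<Rightarrow> (nat \<Rightarrow> real) \<Rightarrow> nat \<Rightarrow> real"
  and order_qty :: "nat \<Rightarrow> real \<Rightarrow> policy \<Rightarrow> (nat \<Rightarrow> real) \<Rightarrow> nat \<Rightarrow> real"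
where
  "inv_level L x1 \<pi> d t =
     (if t \<le> 1 then x1
      else inv_level L x1 \<pi> d (t - 1) + order_qty L x1 \<pi> d (t - 1 - L) - d (t - 1))"
| "order_qty L x1 \<pi> d t =
     (if t = 0 then 0
      else \<pi> (inv_level L x1 \<pi> d t + (\<Sum>t'\<in>{t - L..<t}. order_qty L x1 \<pi> d t')))"
  by pat_completeness auto
termination
  by (relation "measure (case_sum (\<lambda>(_, _, _, _, t). 2 * t) (\<lambda>(_, _, _, _, t). 2 * t + 1))") auto

declare inv_level.simps [simp del] order_qty.simps [simp del]

definition stock_after_replenishment ::
    "nat \<Rightarrow> real \<Rightarrow> policy \<Rightarrow> (nat \<Rightarrow> real) \<Rightarrow> nat \<Rightarrow> real" where
  "stock_after_replenishment L x1 \<pi> d t = inv_level L x1 \<pi> d t + order_qty L x1 \<pi> d (t - L)"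

definition holding_backlog_cost :: "real \<Rightarrow> real \<Rightarrow> real \<Rightarrow> real" where
  "holding_backlog_cost b h x = h * max x 0 + b * max (- x) 0"

definition period_loss ::
    "real \<Rightarrow> real \<Rightarrow> real \<Rightarrow> nat \<Rightarrow> real \<Rightarrow> policy \<Rightarrow> (nat \<Rightarrow> real) \<Rightarrow> nat \<Rightarrow> real" where
  "period_loss b h K L x1 \<pi> d t =
     holding_backlog_cost b h (stock_after_replenishment L x1 \<pi> d t - d t)
     + K * of_bool (order_qty L x1 \<pi> d (t - L) > 0)"

definition avg_loss ::
    "real \<Rightarrow> real \<Rightarrow> real \<Rightarrow> nat \<Rightarrow> nat \<Rightarrow> real \<Rightarrow> policy \<Rightarrow> (nat \<Rightarrow> real) \<Rightarrow> real" where
  "avg_loss b h K L T x1 \<pi> d = (1 / real T) * (\<Sum>t = L + 1..T + L. period_loss b h K L x1 \<pi> d t)"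

definition sS_policy :: "real \<Rightarrow> real \<Rightarrow> policy" where
  "sS_policy s S I = (S - I) * of_bool (I \<le> s)"

definition sS_params :: "real \<Rightarrow> real \<Rightarrow> (real \<times> real) set" where
  "sS_params Hlow H = {(s, S). Hlow \<le> s \<and> s \<le> S \<and> S \<le> H \<and> S \<ge> 0}"

definition sS_loss_class ::
    "real \<Rightarrow> real \<Rightarrow> real \<Rightarrow> nat \<Rightarrow> nat \<Rightarrow> real \<Rightarrow> real \<Rightarrow> real \<Rightarrow> ((nat \<Rightarrow> real) \<Rightarrow> real) set" where
  "sS_loss_class b h K L T x1 Hlow H =
     (\<lambda>(s, S). avg_loss b h K L T x1 (sS_policy s S)) ` sS_params Hlow H"

definition demand_space :: "nat \<Rightarrow> nat \<Rightarrow> real \<Rightarrow> (nat \<Rightarrow> real) set" where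
  "demand_space L T U = {1..T + L} \<rightarrow>\<^sub>E {0..U}"

text \<open>
  Pseudo-shattering of a finite family \<open>ds 1, \<dots>, ds m\<close> of points of \<open>X\<close>, and the pseudo-dimension of
  a class of real functions on \<open>X\<close>. A shattered family is automatically injective. The
  supremum over \<^typ>\<open>enat\<close> is the maximum size if that exists and \<open>\<infinity>\<close> otherwise.
\<close>

definition pseudo_shattered :: "'a set \<Rightarrow> ('a \<Rightarrow> real) set \<Rightarrow> nat \<Rightarrow> (nat \<Rightarrow> 'a) \<Rightarrow> bool" where
  "pseudo_shattered X F m ds \<longleftrightarrow>
     (\<forall>i\<in>{1..m}. ds i \<in> X) \<and>
     (\<exists>\<tau> :: nat \<Rightarrow> real. \<forall>A\<subseteq>{1..m}. \<exists>f\<in>F.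
        (\<forall>i\<in>A. f (ds i) > \<tau> i) \<and> (\<forall>i\<in>{1..m} - A. f (ds i) \<le> \<tau> i))"

definition pseudo_dim :: "'a set \<Rightarrow> ('a \<Rightarrow> real) set \<Rightarrow> enat" where
  "pseudo_dim X F = (SUP m\<in>{m. \<exists>ds. pseudo_shattered X F m ds}. enat m)"

end

theory Submission imports Defs "HOL-Analysis.Line_Segment" begin

text \<open>
  In terms of the inventory position, the gap between \<open>S\<close> and the position after ordering restarts
  at \<open>0\<close> when the demand accumulated since the last order reaches \<open>S - s\<close>. Hence \<open>s\<close> matters only
  through the comparisons of \<open>S - s\<close> with the at most \<open>m T\<^sup>2\<close> partial sums of the demand sequences.
  Once the outcome of these comparisons (and the truth value of \<open>S > x\<^sup>1\<close>, which decides whether the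
  first order costs \<open>K\<close>) is known, each loss is a convex function of \<open>S\<close>, so that its sublevel sets
  are intervals and \<open>S\<close> realises at most \<open>(m + 1)\<^sup>2\<close> patterns. Shattering thus forces
  \<open>2 ^ m \<le> 2 (m T\<^sup>2 + 1) (m + 1)\<^sup>2\<close>.
\<close>

section \<open>Dynamics of the inventory position\<close>

text \<open>The quantity on which \<open>order_qty\<close> lets the policy act, named because its
  recursion is free of the lead time.\<close>

definition inv_position :: "nat \<Rightarrow> real \<Rightarrow> policy \<Rightarrow> (nat \<Rightarrow> real) \<Rightarrow> nat \<Rightarrow> real" where
  "inv_position L x1 \<pi> d t =
     inv_level L x1 \<pi> d t + (\<Sum>j\<in>{t - L..<t}. order_qty L x1 \<pi> d j)"

lemma order_qty_0 [simp]: "order_qty L x1 \<pi> d 0 = 0"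
  by (simp add: order_qty.simps)

lemma order_qty_Suc:
  "order_qty L x1 \<pi> d (Suc n) = \<pi> (inv_position L x1 \<pi> d (Suc n))"
  by (simp add: order_qty.simps[of L x1 \<pi> d "Suc n"] inv_position_def)

lemma inv_position_1: "inv_position L x1 \<pi> d (Suc 0) = x1"
proof -
  have "(\<Sum>j\<in>{Suc 0 - L..<Suc 0}. order_qty L x1 \<pi> d j) = 0"
    by (intro sum.neutral) auto
  then show ?thesis
    by (simp add: inv_position_def inv_level.simps)
qed

text \<open>The arriving order enters the level just as it leaves the window of outstanding orders,
  so only the new order and the demand remain.\<close>

lemma inv_position_Suc:
  assumes "t > 0"
  shows "inv_position L x1 \<pi> d (Suc t) = inv_position L x1 \<pi> d t + order_qty L x1 \<pi> d t - d t"
proof -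
  have level: "inv_level L x1 \<pi> d (Suc t) = inv_level L x1 \<pi> d t + order_qty L x1 \<pi> d (t - L) - d t"
    using assms by (subst inv_level.simps) simp
  have "(\<Sum>j\<in>{Suc t - L..<Suc t}. order_qty L x1 \<pi> d j) + order_qty L x1 \<pi> d (t - L)
      = (\<Sum>j\<in>{t - L..<t}. order_qty L x1 \<pi> d j) + order_qty L x1 \<pi> d t"
  proof (cases "L \<le> t")
    case True
    have "(\<Sum>j\<in>{t - L..<Suc t}. order_qty L x1 \<pi> d j)
      = order_qty L x1 \<pi> d (t - L) + (\<Sum>j\<in>{Suc t - L..<Suc t}. order_qty L x1 \<pi> d j)"
      by (subst sum.atLeast_Suc_lessThan) (use True in \<open>auto simp: Suc_diff_le\<close>)
    moreover have "(\<Sum>j\<in>{t - L..<Suc t}. order_qty L x1 \<pi> d j)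
      = (\<Sum>j\<in>{t - L..<t}. order_qty L x1 \<pi> d j) + order_qty L x1 \<pi> d t"
      by (rule sum.atLeastLessThan_Suc) simp
    ultimately show ?thesis by simp
  next
    \<comment> \<open>Both windows start at index 0, and the arriving order is the one at index 0,
      which vanishes.\<close>
    case False
    then show ?thesis by simp
  qed
  then show ?thesis
    using level by (simp add: inv_position_def)
qed

lemma inv_position_add:
  assumes "t > 0"
  shows "inv_position L x1 \<pi> d (t + k) =
    inv_position L x1 \<pi> d t + (\<Sum>j\<in>{t..<t + k}. order_qty L x1 \<pi> d j) - (\<Sum>j\<in>{t..<t + k}. d j)"
  by (induction k) (use assms in \<open>auto simp: inv_position_Suc\<close>)

text \<open>The orders of periods \<open>{t..<t + L}\<close> are exactly the window of the position
  at \<open>t + L\<close>, so they cancel against \<open>inv_position_add\<close>.\<close>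

lemma stock_after_replenishment_eq:
  assumes "t > 0"
  shows "stock_after_replenishment L x1 \<pi> d (t + L) =
    inv_position L x1 \<pi> d t + order_qty L x1 \<pi> d t - (\<Sum>j\<in>{t..<t + L}. d j)"
  using inv_position_add[OF assms, of L x1 \<pi> d L]
  by (simp add: inv_position_def[of _ _ _ _ "t + L"] stock_after_replenishment_def)

section \<open>The gap process and its thresholds\<close>

text \<open>\<open>gap \<Delta> d n\<close> is \<open>S\<close> minus the inventory position after ordering in period \<open>n + 1\<close>.\<close>

primrec gap :: "real \<Rightarrow> (nat \<Rightarrow> real) \<Rightarrow> nat \<Rightarrow> real" where
  "gap \<Delta> d 0 = 0"
| "gap \<Delta> d (Suc n) = (if \<Delta> \<le> gap \<Delta> d n + d (Suc n) then 0 else gap \<Delta> d n + d (Suc n))"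

text \<open>Take \<open>a\<close> to be the last restart. The possible values thus come from a
  finite list independent of \<open>\<Delta>\<close>.\<close>

lemma gap_eq_partial_sum: "\<exists>a\<le>n. gap \<Delta> d n = (\<Sum>j\<in>{a<..n}. d j)"
proof (induction n)
  case (Suc n)
  then obtain a where a: "a \<le> n" "gap \<Delta> d n = (\<Sum>j\<in>{a<..n}. d j)" by blast
  have "{a<..Suc n} = insert (Suc n) {a<..n}" using a(1) by auto
  then have "gap \<Delta> d n + d (Suc n) = (\<Sum>j\<in>{a<..Suc n}. d j)" using a(2) by simp
  then show ?case
    using a(1) by (cases "\<Delta> \<le> gap \<Delta> d n + d (Suc n)") (auto intro: exI[of _ "Suc n"] exI[of _ a])
qed simp

text \<open>Serves both as the induction step of \<open>gap_cong\<close> and for comparing orders in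
  \<open>decoupled_loss_cong\<close>.\<close>

lemma threshold_gap_cong:
  assumes "\<And>a n. a < T \<Longrightarrow> n < T \<Longrightarrow>
      \<Delta> \<le> (\<Sum>j\<in>{a<..Suc n}. d j) \<longleftrightarrow> \<Delta>' \<le> (\<Sum>j\<in>{a<..Suc n}. d j)"
    and "n < T"
    and "gap \<Delta> d n = gap \<Delta>' d n"
  shows "\<Delta> \<le> gap \<Delta> d n + d (Suc n) \<longleftrightarrow> \<Delta>' \<le> gap \<Delta>' d n + d (Suc n)"
proof -
  obtain a where a: "a \<le> n" "gap \<Delta> d n = (\<Sum>j\<in>{a<..n}. d j)"
    using gap_eq_partial_sum by blast
  have "{a<..Suc n} = insert (Suc n) {a<..n}" using a(1) by auto
  then have "gap \<Delta> d n + d (Suc n) = (\<Sum>j\<in>{a<..Suc n}. d j)" using a(2) by simp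
  then show ?thesis using assms(1)[of a n] assms(2,3) a(1) by simp
qed

lemma gap_cong:
  assumes "\<And>a n. a < T \<Longrightarrow> n < T \<Longrightarrow>
      \<Delta> \<le> (\<Sum>j\<in>{a<..Suc n}. d j) \<longleftrightarrow> \<Delta>' \<le> (\<Sum>j\<in>{a<..Suc n}. d j)"
    and "n < T"
  shows "gap \<Delta> d n = gap \<Delta>' d n"
  using \<open>n < T\<close>
proof (induction n)
  case (Suc n)
  then have "gap \<Delta> d n = gap \<Delta>' d n" by simp
  then show ?case
    using threshold_gap_cong[of T \<Delta> d \<Delta>' n, OF assms(1)] Suc.prems by simp
qed simp

text \<open>Since \<open>x1 \<le> s\<close>, period 1 orders up to \<open>S\<close> and the gap
  starts at 0; afterwards a position is at most \<open>s\<close> iff its distance to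
  \<open>S\<close> is at least \<open>S - s\<close>.\<close>

lemma sS_position_after_ordering:
  assumes "x1 \<le> s"
  shows "inv_position L x1 (sS_policy s S) d (Suc n) + order_qty L x1 (sS_policy s S) d (Suc n)
    = S - gap (S - s) d n"
proof (induction n)
  case 0
  then show ?case using assms by (simp add: order_qty_Suc inv_position_1 sS_policy_def)
next
  case (Suc n)
  have "inv_position L x1 (sS_policy s S) d (Suc (Suc n)) = S - (gap (S - s) d n + d (Suc n))"
    using Suc.IH by (subst inv_position_Suc) auto
  then show ?case
    unfolding order_qty_Suc[of _ _ _ _ "Suc n"] by (simp only:) (auto simp: sS_policy_def)
qed

lemma sS_order_qty_Suc_0:
  assumes "x1 \<le> s"
  shows "order_qty L x1 (sS_policy s S) d (Suc 0) > 0 \<longleftrightarrow> S > x1"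
  using assms by (simp add: order_qty_Suc inv_position_1 sS_policy_def)

text \<open>Positivity is a separate condition: for \<open>s = S\<close> a period without demand
  meets the threshold but orders nothing.\<close>

lemma sS_order_qty_Suc_Suc:
  assumes "x1 \<le> s"
  shows "order_qty L x1 (sS_policy s S) d (Suc (Suc n)) > 0 \<longleftrightarrow>
    gap (S - s) d n + d (Suc n) > 0 \<and> S - s \<le> gap (S - s) d n + d (Suc n)"
proof -
  have "inv_position L x1 (sS_policy s S) d (Suc (Suc n)) = S - (gap (S - s) d n + d (Suc n))"
    using sS_position_after_ordering[OF assms, of L S d n] by (subst inv_position_Suc) auto
  then show ?thesis
    unfolding order_qty_Suc[of _ _ _ _ "Suc n"] by (simp only:) (auto simp: sS_policy_def)
qed

definition order_placed :: "bool \<Rightarrow> real \<Rightarrow> (nat \<Rightarrow> real) \<Rightarrow> nat \<Rightarrow> bool" where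
  "order_placed p \<Delta> d n = (case n of 0 \<Rightarrow> p
     | Suc k \<Rightarrow> gap \<Delta> d k + d (Suc k) > 0 \<and> \<Delta> \<le> gap \<Delta> d k + d (Suc k))"

text \<open>The loss with the truth value of \<open>S > x\<^sup>1\<close> and the difference \<open>\<Delta> = S - s\<close> decoupled from \<open>S\<close>.\<close>

definition decoupled_loss ::
    "real \<Rightarrow> real \<Rightarrow> real \<Rightarrow> nat \<Rightarrow> nat \<Rightarrow> bool \<Rightarrow> real \<Rightarrow> (nat \<Rightarrow> real) \<Rightarrow> real \<Rightarrow> real" where
  "decoupled_loss b h K L T p \<Delta> d S = (1 / real T) *
     (\<Sum>n<T. holding_backlog_cost b h (S - (gap \<Delta> d n + (\<Sum>j\<in>{Suc n..Suc n + L}. d j)))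
        + K * of_bool (order_placed p \<Delta> d n))"

lemma avg_loss_sS_policy:
  assumes "x1 \<le> s"
  shows "avg_loss b h K L T x1 (sS_policy s S) d = decoupled_loss b h K L T (S > x1) (S - s) d S"
proof -
  have period: "period_loss b h K L x1 (sS_policy s S) d (Suc n + L) =
      holding_backlog_cost b h (S - (gap (S - s) d n + (\<Sum>j\<in>{Suc n..Suc n + L}. d j)))
      + K * of_bool (order_placed (S > x1) (S - s) d n)" for n
  proof -
    have "{Suc n..Suc n + L} = insert (Suc n + L) {Suc n..<Suc n + L}" by auto
    then have "stock_after_replenishment L x1 (sS_policy s S) d (Suc n + L) - d (Suc n + L)
        = S - (gap (S - s) d n + (\<Sum>j\<in>{Suc n..Suc n + L}. d j))"
      unfolding stock_after_replenishment_eq[OF zero_less_Suc] sS_position_after_ordering[OF assms]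
      by simp
    moreover have "order_qty L x1 (sS_policy s S) d (Suc n + L - L) > 0
        \<longleftrightarrow> order_placed (S > x1) (S - s) d n"
      by (cases n)
        (simp_all add: order_placed_def sS_order_qty_Suc_0[OF assms] sS_order_qty_Suc_Suc[OF assms])
    ultimately show ?thesis by (simp only: period_loss_def)
  qed
  \<comment> \<open>The loss of period \<open>Suc n + L\<close> is attributed to the ordering period
    \<open>Suc n\<close>.\<close>
  have "(\<Sum>t = L + 1..T + L. period_loss b h K L x1 (sS_policy s S) d t)
      = (\<Sum>n<T. period_loss b h K L x1 (sS_policy s S) d (Suc n + L))"
    by (rule sum.reindex_bij_witness[of _ "\<lambda>n. Suc n + L" "\<lambda>t. t - Suc L"]) auto
  then show ?thesis by (simp only: avg_loss_def decoupled_loss_def period)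
qed

text \<open>An equality of functions of \<open>S\<close>, so that sublevel sets can be identified as
  wholes.\<close>

lemma decoupled_loss_cong:
  assumes "\<And>a n. a < T \<Longrightarrow> n < T \<Longrightarrow>
      \<Delta> \<le> (\<Sum>j\<in>{a<..Suc n}. d j) \<longleftrightarrow> \<Delta>' \<le> (\<Sum>j\<in>{a<..Suc n}. d j)"
  shows "decoupled_loss b h K L T p \<Delta> d = decoupled_loss b h K L T p \<Delta>' d"
proof -
  have gap: "gap \<Delta> d n = gap \<Delta>' d n" if "n < T" for n
    by (rule gap_cong[OF assms that])
  have "\<Delta> \<le> gap \<Delta> d n + d (Suc n) \<longleftrightarrow> \<Delta>' \<le> gap \<Delta>' d n + d (Suc n)" if "n < T" for n
    by (rule threshold_gap_cong[OF assms that gap[OF that]])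
  then have "order_placed p \<Delta> d n = order_placed p \<Delta>' d n" if "n < T" for n
    using that gap by (cases n) (simp_all add: order_placed_def)
  with gap show ?thesis
    by (simp add: decoupled_loss_def fun_eq_iff)
qed

section \<open>Sublevel sets\<close>

lemma holding_backlog_cost_convex:
  assumes "b \<ge> 0" "h \<ge> 0"
  shows "convex_on UNIV (\<lambda>S. holding_backlog_cost b h (S - e))"
proof (rule convex_onI)
  fix t x y :: real
  assume t: "0 < t" "t < 1"
  have pos: "max ((1 - t) * u + t * v) 0 \<le> (1 - t) * max u 0 + t * max v 0" for u v :: real
  proof -
    have "(1 - t) * u + t * v \<le> (1 - t) * max u 0 + t * max v 0"
      using t by (intro add_mono mult_left_mono) auto
    moreover have "0 \<le> (1 - t) * max u 0 + t * max v 0"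
      using t by (intro add_nonneg_nonneg mult_nonneg_nonneg) auto
    ultimately show ?thesis by simp
  qed
  let ?u = "x - e" and ?v = "y - e"
  have eq: "(1 - t) *\<^sub>R x + t *\<^sub>R y - e = (1 - t) * ?u + t * ?v"
       "- ((1 - t) * ?u + t * ?v) = (1 - t) * (- ?u) + t * (- ?v)"
    by (simp_all add: algebra_simps)
  have "holding_backlog_cost b h ((1 - t) *\<^sub>R x + t *\<^sub>R y - e)
      \<le> h * ((1 - t) * max ?u 0 + t * max ?v 0) + b * ((1 - t) * max (- ?u) 0 + t * max (- ?v) 0)"
    unfolding holding_backlog_cost_def eq
    using pos[of ?u ?v] pos[of "- ?u" "- ?v"] assms by (intro add_mono mult_left_mono) auto
  also have "\<dots> = (1 - t) * holding_backlog_cost b h ?u + t * holding_backlog_cost b h ?v"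
    unfolding holding_backlog_cost_def by (simp only: ring_distribs ac_simps)
  finally show "holding_backlog_cost b h ((1 - t) *\<^sub>R x + t *\<^sub>R y - e)
      \<le> (1 - t) * holding_backlog_cost b h ?u + t * holding_backlog_cost b h ?v" .
qed simp

lemma convex_on_sum_functions:
  assumes "convex S" "\<And>i. i \<in> I \<Longrightarrow> convex_on S (f i)"
  shows "convex_on S (\<lambda>x. \<Sum>i\<in>I. f i x)"
  using assms(2)
  by (induction I rule: infinite_finite_induct)
    (auto simp: convex_on_const \<open>convex S\<close>)

text \<open>With \<open>p\<close> and \<open>\<Delta>\<close> fixed, gaps and fixed costs are
  constants; only translates of the convex cost depend on \<open>S\<close>.\<close>

lemma decoupled_loss_convex:
  assumes "b \<ge> 0" "h \<ge> 0"
  shows "convex_on UNIV (decoupled_loss b h K L T p \<Delta> d)"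
  unfolding decoupled_loss_def
  by (intro convex_on_const[THEN iffD2] convex_on_cmul convex_on_sum_functions convex_on_add
      holding_backlog_cost_convex assms) auto

lemma convex_on_le_between:
  fixes f :: "real \<Rightarrow> real"
  assumes "convex_on UNIV f" "x \<le> y" "y \<le> z" "f x \<le> c" "f z \<le> c"
  shows "f y \<le> c"
proof -
  have "y \<in> closed_segment x z"
    using assms(2,3) by (auto simp: closed_segment_eq_real_ivl)
  then obtain u where "y = (1 - u) *\<^sub>R x + u *\<^sub>R z" "0 \<le> u" "u \<le> 1"
    by (auto simp: in_segment)
  then have "f y \<le> max (f x) (f z)"
    using convex_lower[OF assms(1), of x z "1 - u" u] by simp
  then show ?thesis using assms(4,5) by simp
qed

section \<open>Counting patterns\<close>

text \<open>Encodes each member of a chain of finite sets by a single number, which is what keeps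
  the pattern counts polynomial.\<close>

lemma card_chain_eq:
  assumes "finite A" "finite B" "A \<subseteq> B \<or> B \<subseteq> A" "card A = card B"
  shows "A = B"
  using assms card_subset_eq by metis

lemma threshold_pattern_eq:
  fixes v :: "'i \<Rightarrow> 'a :: linorder"
  assumes "finite I" "card {i \<in> I. x \<le> v i} = card {i \<in> I. y \<le> v i}"
  shows "{i \<in> I. x \<le> v i} = {i \<in> I. y \<le> v i}"
  by (rule card_chain_eq) (use assms linear[of x y] in auto)

text \<open>A point lies in an interval iff the interval has a point on either side of it, in the
  weak sense. Each one-sided condition is monotone in \<open>S\<close>, so its index sets form a
  chain.\<close>

lemma interval_pattern_eq:
  fixes J :: "'i \<Rightarrow> 'a :: linorder set"
  assumes "finite I"
    and interval: "\<And>i x y z. i \<in> I \<Longrightarrow> x \<in> J i \<Longrightarrow> z \<in> J i \<Longrightarrow> x \<le> y \<Longrightarrow> y \<le> z \<Longrightarrow> y \<in> J i"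
    and low: "card {i \<in> I. \<exists>x\<in>J i. x \<le> S} = card {i \<in> I. \<exists>x\<in>J i. x \<le> S'}"
    and high: "card {i \<in> I. \<exists>x\<in>J i. S \<le> x} = card {i \<in> I. \<exists>x\<in>J i. S' \<le> x}"
    and "i \<in> I"
  shows "S \<in> J i \<longleftrightarrow> S' \<in> J i"
proof -
  have "{i \<in> I. \<exists>x\<in>J i. x \<le> S} = {i \<in> I. \<exists>x\<in>J i. x \<le> S'}"
    by (rule card_chain_eq[OF _ _ _ low]) (use \<open>finite I\<close> linear[of S S'] in \<open>fastforce+\<close>)
  moreover have "{i \<in> I. \<exists>x\<in>J i. S \<le> x} = {i \<in> I. \<exists>x\<in>J i. S' \<le> x}"
    by (rule card_chain_eq[OF _ _ _ high]) (use \<open>finite I\<close> linear[of S S'] in \<open>fastforce+\<close>)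
  ultimately show ?thesis
    using interval \<open>i \<in> I\<close> by blast
qed

lemma pseudo_shattered_sS_bound:
  assumes "b \<ge> 0" "h \<ge> 0" "x1 \<le> Hlow"
    and "pseudo_shattered X (sS_loss_class b h K L T x1 Hlow H) m ds"
  shows "2 ^ m \<le> 2 * (m * T ^ 2 + 1) * (m + 1) ^ 2"
proof -
  let ?I = "{1..m}"
  let ?V = "?I \<times> {..<T} \<times> {..<T}"
  let ?v = "\<lambda>(i, a, n). \<Sum>j\<in>{a<..Suc n}. ds i j"
  obtain \<tau> where \<tau>: "\<forall>A\<subseteq>?I. \<exists>f\<in>sS_loss_class b h K L T x1 Hlow H.
      (\<forall>i\<in>A. f (ds i) > \<tau> i) \<and> (\<forall>i\<in>?I - A. f (ds i) \<le> \<tau> i)"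
    using assms(4) by (auto simp: pseudo_shattered_def)
  define J where "J p \<Delta> i = {S. decoupled_loss b h K L T p \<Delta> (ds i) S \<le> \<tau> i}" for p \<Delta> i
  have "\<exists>q::real \<times> real. \<forall>i\<in>?I. i \<notin> A \<longleftrightarrow> snd q \<in> J (snd q > x1) (fst q) i"
    if A: "A \<subseteq> ?I" for A
  proof -
    obtain s S where "Hlow \<le> s"
      and "\<forall>i\<in>A. avg_loss b h K L T x1 (sS_policy s S) (ds i) > \<tau> i"
        "\<forall>i\<in>?I - A. avg_loss b h K L T x1 (sS_policy s S) (ds i) \<le> \<tau> i"
      using \<tau>[rule_format, OF A] by (auto simp: sS_loss_class_def sS_params_def)
    then have "\<forall>i\<in>?I. i \<notin> A \<longleftrightarrow> S \<in> J (S > x1) (S - s) i"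
      using \<open>x1 \<le> Hlow\<close> by (auto simp: J_def avg_loss_sS_policy not_less[symmetric])
    then show ?thesis by (intro exI[of _ "(S - s, S)"]) simp
  qed
  then obtain q :: "nat set \<Rightarrow> real \<times> real" where
    q: "\<And>A i. A \<subseteq> ?I \<Longrightarrow> i \<in> ?I \<Longrightarrow> i \<notin> A \<longleftrightarrow> snd (q A) \<in> J (snd (q A) > x1) (fst (q A)) i"
    by metis
  \<comment> \<open>The key records whether the first order is positive, the position of
    \<open>\<Delta>\<close> among the partial sums, and the position of \<open>S\<close> relative to
    the sublevel intervals.\<close>
  define key where "key A = (let \<Delta> = fst (q A); S = snd (q A); p = (S > x1) in
      (p, card {w \<in> ?V. \<Delta> \<le> ?v w},
       card {i \<in> ?I. \<exists>x\<in>J p \<Delta> i. x \<le> S}, card {i \<in> ?I. \<exists>x\<in>J p \<Delta> i. S \<le> x}))" for A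
  have "inj_on key (Pow ?I)"
  proof (rule inj_onI)
    fix A B assume AB: "A \<in> Pow ?I" "B \<in> Pow ?I" and "key A = key B"
    define \<Delta> S p where "\<Delta> = fst (q A)" and "S = snd (q A)" and "p = (S > x1)"
    define \<Delta>' S' where "\<Delta>' = fst (q B)" and "S' = snd (q B)"
    have key_A: "key A = (p, card {w \<in> ?V. \<Delta> \<le> ?v w},
        card {i \<in> ?I. \<exists>x\<in>J p \<Delta> i. x \<le> S}, card {i \<in> ?I. \<exists>x\<in>J p \<Delta> i. S \<le> x})"
      by (simp only: key_def Let_def p_def S_def \<Delta>_def)
    have key_B: "key B = (S' > x1, card {w \<in> ?V. \<Delta>' \<le> ?v w},
        card {i \<in> ?I. \<exists>x\<in>J (S' > x1) \<Delta>' i. x \<le> S'},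
        card {i \<in> ?I. \<exists>x\<in>J (S' > x1) \<Delta>' i. S' \<le> x})"
      by (simp only: key_def Let_def S'_def \<Delta>'_def)
    have p': "(S' > x1) = p"
      using \<open>key A = key B\<close> unfolding key_A key_B by simp
    have thr: "card {w \<in> ?V. \<Delta> \<le> ?v w} = card {w \<in> ?V. \<Delta>' \<le> ?v w}"
      and low: "card {i \<in> ?I. \<exists>x\<in>J p \<Delta> i. x \<le> S} = card {i \<in> ?I. \<exists>x\<in>J p \<Delta>' i. x \<le> S'}"
      and high: "card {i \<in> ?I. \<exists>x\<in>J p \<Delta> i. S \<le> x} = card {i \<in> ?I. \<exists>x\<in>J p \<Delta>' i. S' \<le> x}"
      using \<open>key A = key B\<close>[unfolded key_A key_B p'] by (simp_all only: prod.inject)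
    have V: "{w \<in> ?V. \<Delta> \<le> ?v w} = {w \<in> ?V. \<Delta>' \<le> ?v w}"
      by (rule threshold_pattern_eq[OF _ thr]) simp
    have "\<Delta> \<le> (\<Sum>j\<in>{a<..Suc n}. ds i j) \<longleftrightarrow> \<Delta>' \<le> (\<Sum>j\<in>{a<..Suc n}. ds i j)"
      if "i \<in> ?I" "a < T" "n < T" for i a n
      using V[THEN eqset_imp_iff, of "(i, a, n)"] that by simp
    \<comment> \<open>Equal threshold patterns give the same intervals for \<open>A\<close> and
      \<open>B\<close>, so the last two key entries count within one family.\<close>
    then have J: "J p \<Delta> i = J p \<Delta>' i" if "i \<in> ?I" for i
      using decoupled_loss_cong[of T \<Delta> "ds i" \<Delta>'] that by (simp add: J_def)
    then have sets: "{i \<in> ?I. \<exists>x\<in>J p \<Delta> i. Q x} = {i \<in> ?I. \<exists>x\<in>J p \<Delta>' i. Q x}" for Q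
      by blast
    have "S \<in> J p \<Delta>' i \<longleftrightarrow> S' \<in> J p \<Delta>' i" if "i \<in> ?I" for i
    proof (rule interval_pattern_eq[OF _ _ low[unfolded sets] high[unfolded sets] that])
      show "y \<in> J p \<Delta>' k" if "x \<in> J p \<Delta>' k" "z \<in> J p \<Delta>' k" "x \<le> y" "y \<le> z" for x y z k
        using that convex_on_le_between[OF decoupled_loss_convex[OF assms(1,2)]]
        by (auto simp: J_def)
    qed simp
    then have "i \<notin> A \<longleftrightarrow> i \<notin> B" if "i \<in> ?I" for i
      using q[of A i] q[of B i] AB J p' that
      by (simp add: p_def S_def \<Delta>_def S'_def \<Delta>'_def)
    then show "A = B" using AB by blast
  qed
  let ?N = "m * T ^ 2"
  have "card {w \<in> ?V. x \<le> ?v w} \<le> ?N" for x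
    by (rule order_trans[OF card_mono[of ?V]]) (auto simp: power2_eq_square)
  moreover have "card {i \<in> ?I. P i} \<le> m" for P
    by (rule order_trans[OF card_mono[of ?I]]) auto
  ultimately have "key ` Pow ?I \<subseteq> UNIV \<times> {..?N} \<times> {..m} \<times> {..m}"
    by (auto simp: key_def Let_def)
  then have "card (Pow ?I) \<le> card ((UNIV :: bool set) \<times> {..?N} \<times> {..m} \<times> {..m})"
    by (rule card_inj_on_le[OF \<open>inj_on key (Pow ?I)\<close>]) simp
  then show ?thesis
    by (simp add: card_Pow card_cartesian_product power2_eq_square mult.assoc)
qed

section \<open>From the counting inequality to a logarithmic bound\<close>

lemma exponential_le_polynomial_imp_le_ln:
  fixes m T :: nat
  assumes "T \<ge> 2" "2 ^ m \<le> 2 * (m * T ^ 2 + 1) * (m + 1) ^ 2"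
  shows "real m \<le> 60 * ln (real T)"
proof -
  have "m * T ^ 2 + 1 \<le> (m + 1) * T ^ 2"
    using \<open>T \<ge> 2\<close> by (simp add: Suc_le_eq)
  then have "2 * (m * T ^ 2 + 1) * (m + 1) ^ 2 \<le> 2 * ((m + 1) * T ^ 2) * (m + 1) ^ 2"
    by (intro mult_le_mono) auto
  then have "2 ^ m \<le> 2 * T ^ 2 * (m + 1) ^ 3"
    using assms(2) by (simp add: power2_eq_square power3_eq_cube algebra_simps)
  then have "real (2 ^ m) \<le> real (2 * T ^ 2 * (m + 1) ^ 3)"
    by (rule of_nat_mono)
  then have "ln (2 ^ m :: real) \<le> ln (2 * real T ^ 2 * (real m + 1) ^ 3)"
    by (subst ln_le_cancel_iff) (use \<open>T \<ge> 2\<close> in \<open>auto simp: add.commute\<close>)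
  also have "\<dots> = ln 2 + 2 * ln T + 3 * ln (real m + 1)"
    using \<open>T \<ge> 2\<close> by (simp add: ln_mult ln_realpow)
  \<comment> \<open>The denominator 12 makes three such terms contribute \<open>m / 4\<close>, half
    of the lower bound \<open>m / 2\<close> for \<open>m * ln 2\<close>.\<close>
  also have "ln (real m + 1) \<le> 4 * ln 2 + real m / 12"
  proof -
    have "ln (real m + 1) \<le> ln (16 * (1 + real m / 12))"
      by (subst ln_le_cancel_iff) auto
    also have "\<dots> = ln (2 ^ 4) + ln (1 + real m / 12)"
      by (subst ln_mult) auto
    also have "\<dots> \<le> 4 * ln 2 + real m / 12"
      using ln_add_one_self_le_self[of "real m / 12"] by (simp add: ln_realpow del: power_numeral)
    finally show ?thesis .
  qed
  finally have "real m * ln 2 \<le> 13 * ln 2 + 2 * ln T + real m / 4"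
    by (simp add: ln_realpow)
  moreover have "ln 2 \<le> ln (real T)"
    using \<open>T \<ge> 2\<close> by simp
  moreover have "real m * (1 / 2) \<le> real m * ln 2"
    using ln_le_minus_one[of "1 / 2 :: real"] by (intro mult_left_mono) (auto simp: ln_div)
  \<comment> \<open>With \<open>ln 2 \<le> ln T\<close> this reads
    \<open>m / 2 \<le> 15 * ln T + m / 4\<close>, whence the constant 60.\<close>
  ultimately show ?thesis by (simp add: field_simps)
qed

theorem theorem2:
  "\<exists>(C::real) (T0::nat). C > 0 \<and> T0 > 0 \<and>
     (\<forall>(U::real) (b::real) (h::real) (K::real) (L::nat) (T::nat) (H::real) (Hlow::real) (x1::real).
        U > 0 \<longrightarrow> b \<in> {0..1} \<longrightarrow> h \<in> {0..1} \<longrightarrow> K \<ge> 0 \<longrightarrow> T \<ge> T0 \<longrightarrow>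
        H > 0 \<longrightarrow> Hlow \<le> H \<longrightarrow> x1 \<le> 0 \<longrightarrow> x1 \<le> Hlow \<longrightarrow>
        ereal_of_enat (pseudo_dim (demand_space L T U) (sS_loss_class b h K L T x1 Hlow H))
          \<le> ereal (C * ln (real T)))"
proof (intro exI[of _ "60 :: real"] exI[of _ "2 :: nat"] conjI allI impI)
  fix U b h K :: real and L T :: nat and H Hlow x1 :: real
  assume b: "b \<in> {0..1}" and h: "h \<in> {0..1}" and T: "T \<ge> 2" and "x1 \<le> Hlow"
  let ?F = "sS_loss_class b h K L T x1 Hlow H"
  \<comment> \<open>The supremum is taken in \<open>enat\<close>, so the real bound is first rounded
    down to a natural number.\<close>
  define N where "N = nat \<lfloor>60 * ln (real T)\<rfloor>"
  have ln_nonneg: "0 \<le> ln (real T)"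
    using T by simp
  have "pseudo_dim (demand_space L T U) ?F \<le> enat N"
    unfolding pseudo_dim_def
  proof (rule SUP_least)
    fix m assume "m \<in> {m. \<exists>ds. pseudo_shattered (demand_space L T U) ?F m ds}"
    then have "real m \<le> 60 * ln (real T)"
      using pseudo_shattered_sS_bound[of b h x1 Hlow] b h \<open>x1 \<le> Hlow\<close>
      by (intro exponential_le_polynomial_imp_le_ln[OF T]) auto
    then show "enat m \<le> enat N"
      unfolding N_def by (simp add: le_nat_floor)
  qed
  then have "ereal_of_enat (pseudo_dim (demand_space L T U) ?F) \<le> ereal_of_enat (enat N)"
    by (simp only: ereal_of_enat_le_iff)
  also have "\<dots> \<le> ereal (60 * ln (real T))"
    using ln_nonneg by (simp add: N_def)
  finally show "ereal_of_enat (pseudo_dim (demand_space L T U) ?F) \<le> ereal (60 * ln (real T))" .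
qed auto

end
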